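(* Let $G:\mathbb B^2\to\mathbb C^2$ be an autonomous Herglotz vector field associated with the class $\mathcal M$ (i.e. $-G\in\mathcal M$), with power series expansion $$G(z_1,z_2)=\Big(-z_1+\sum_{\alpha\in\mathbb N^2,\,|\alpha|\ge 2}q^1_\alpha z^\alpha,\ -z_2+\sum_{\alpha\in\mathbb N^2,\,|\alpha|\ge 2}q^2_\alpha z^\alpha\Big)$$ at the origin. Let $k_1,k_2\in\mathbb Z$. Then $$G^{(k_1,k_2)}(z)=\Big(-z_1+\sum_{\substack{|\alpha|\ge 2\\ (\alpha_1-1)k_1+\alpha_2k_2=0}}q^1_\alpha z^\alpha,\ -z_2+\sum_{\substack{|\alpha|\ge 2\\ \alpha_1k_1+(\alpha_2-1)k_2=0}}q^2_\alpha z^\alpha\Big)$$ is again an autonomous Herglotz vector field associated with the class $\mathcal M$ on $\mathbb B^2$, i.e. $-G^{(k_1,k_2)}\in\mathcal M$.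
   Context: $\mathbb B^2\subset\mathbb C^2$ is the open Euclidean unit ball, $\langle\cdot,\cdot\rangle$ is the standard Hermitian inner product, $\langle z,w\rangle=z_1\overline{w_1}+z_2\overline{w_2}$, and $\mathbb N$ is the set of nonnegative integers. For $\alpha=(\alpha_1,\alpha_2)\in\mathbb N^2$, $|\alpha|=\alpha_1+\alpha_2$ and $z^\alpha=z_1^{\alpha_1}z_2^{\alpha_2}$. The class $\mathcal M$ is the set of holomorphic maps $h:\mathbb B^2\to\mathbb C^2$ such that $h(0)=0$, $dh_0=\mathrm{id}$, and $\mathrm{Re}\,\langle h(z),z\rangle>0$ for all $z\in\mathbb B^2\setminus\{0\}$. An autonomous Herglotz vector field associated with the class $\mathcal M$ on $\mathbb B^2$ is a (time-independent) holomorphic map $G:\mathbb B^2\to\mathbb C^2$ with $-G\in\mathcal M$. *)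

theory Defs
  imports "HOL-Analysis.Analysis"
begin

definition hermitian_inner :: "complex^2 \<Rightarrow> complex^2 \<Rightarrow> complex" where
  "hermitian_inner z w = z $ 1 * cnj (w $ 1) + z $ 2 * cnj (w $ 2)"

text \<open>Multiplication by a complex matrix is the general complex-linear map, so this is complex
  Frechet differentiability at every point of \<open>S\<close>; it is meant for open \<open>S\<close>.\<close>

definition holomorphic_map_on :: "(complex^2 \<Rightarrow> complex^2) \<Rightarrow> (complex^2) set \<Rightarrow> bool" where
  "holomorphic_map_on f S \<longleftrightarrow>
     (\<forall>z\<in>S. \<exists>A :: complex^2^2. (f has_derivative (\<lambda>v. A *v v)) (at z))"

text \<open>Maps on the unit ball are total functions on \<open>complex^2\<close>; only their values on
  \<open>ball 0 1\<close> matter below. The norm of \<open>complex^2\<close> is the Euclidean one.\<close>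

definition class_M :: "(complex^2 \<Rightarrow> complex^2) set" where
  "class_M = {h. holomorphic_map_on h (ball 0 1) \<and> h 0 = 0 \<and>
     (h has_derivative id) (at 0) \<and>
     (\<forall>z \<in> ball 0 1 - {0}. Re (hermitian_inner (h z) z) > 0)}"

definition autonomous_herglotz :: "(complex^2 \<Rightarrow> complex^2) \<Rightarrow> bool" where
  "autonomous_herglotz G \<longleftrightarrow> holomorphic_map_on G (ball 0 1) \<and> (\<lambda>z. - G z) \<in> class_M"

definition monomial2 :: "nat \<times> nat \<Rightarrow> complex^2 \<Rightarrow> complex" where
  "monomial2 \<alpha> z = (z $ 1) ^ fst \<alpha> * (z $ 2) ^ snd \<alpha>"

definition higher_indices :: "(nat \<times> nat) set" where
  "higher_indices = {\<alpha>. fst \<alpha> + snd \<alpha> \<ge> 2}"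

text \<open>The expansion is required only near the origin. Multi-index series are summed
  unconditionally, i.e. absolutely.\<close>

definition has_expansion ::
  "(complex^2 \<Rightarrow> complex^2) \<Rightarrow> (nat \<times> nat \<Rightarrow> complex) \<Rightarrow> (nat \<times> nat \<Rightarrow> complex) \<Rightarrow> bool" where
  "has_expansion G q1 q2 \<longleftrightarrow> (\<forall>\<^sub>F z in nhds 0.
     ((\<lambda>\<alpha>. q1 \<alpha> * monomial2 \<alpha> z) has_sum (G z $ 1 - (- (z $ 1)))) higher_indices \<and>
     ((\<lambda>\<alpha>. q2 \<alpha> * monomial2 \<alpha> z) has_sum (G z $ 2 - (- (z $ 2)))) higher_indices)"

definition indices1 :: "int \<Rightarrow> int \<Rightarrow> (nat \<times> nat) set" where
  "indices1 k1 k2 =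
     {\<alpha> \<in> higher_indices. (int (fst \<alpha>) - 1) * k1 + int (snd \<alpha>) * k2 = 0}"

definition indices2 :: "int \<Rightarrow> int \<Rightarrow> (nat \<times> nat) set" where
  "indices2 k1 k2 =
     {\<alpha> \<in> higher_indices. int (fst \<alpha>) * k1 + (int (snd \<alpha>) - 1) * k2 = 0}"

text \<open>\<open>infsum\<close> is 0 for a divergent series, so convergence has to be stated alongside any
  use of this field.\<close>

definition projected_field ::
  "int \<Rightarrow> int \<Rightarrow> (nat \<times> nat \<Rightarrow> complex) \<Rightarrow> (nat \<times> nat \<Rightarrow> complex) \<Rightarrow> complex^2 \<Rightarrow> complex^2" where
  "projected_field k1 k2 q1 q2 z = vector
     [- (z $ 1) + (\<Sum>\<^sub>\<infinity>\<alpha>\<in>indices1 k1 k2. q1 \<alpha> * monomial2 \<alpha> z),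
      - (z $ 2) + (\<Sum>\<^sub>\<infinity>\<alpha>\<in>indices2 k1 k2. q2 \<alpha> * monomial2 \<alpha> z)]"

end

theory Submission
  imports Defs "HOL-Complex_Analysis.Cauchy_Integral_Formula"
begin

text \<open>
  Write \<open>R\<^sub>t z = (cis (k1 t) z\<^sub>1, cis (k2 t) z\<^sub>2)\<close>. Conjugating \<open>G\<close> with the unitary map \<open>R\<^sub>t\<close> multiplies
  the coefficient of \<open>z\<^sup>\<alpha>\<close> in the first component by \<open>cis (((\<alpha>\<^sub>1 - 1) k1 + \<alpha>\<^sub>2 k2) t)\<close>, and similarly in
  the second. Averaging the conjugates over \<open>t\<close> therefore keeps exactly the terms of the projected
  field. Since \<open>R\<^sub>t\<close> preserves the ball and the Hermitian product, every conjugate of \<open>-G\<close> satisfies the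
  positivity condition defining the class, and the average inherits it: by compactness of the torus
  through \<open>z\<close> the real part has a positive minimum there (\<open>torus_min\<close>), so strictness survives.
  The average over the circle is taken as a limit of averages over \<open>N\<close>-th roots of unity
  (\<open>circle_average_tendsto\<close>), which turns it into an exchange of a limit and a dominated series and
  avoids integration.

  What remains is analytic: the expansion is given only near the origin, yet the projected series
  has to converge, and to be holomorphic, on the whole ball. On a complex line through the origin the
  homogeneous parts of the expansion are the Taylor coefficients of a function of one variable, so
  Cauchy's inequality bounds them by the maximum of \<open>G\<close>. A second use of that inequality, on the
  polynomial obtained by scaling \<open>z\<^sub>2\<close> in a homogeneous part, bounds each single term
  (\<open>terms_bounded\<close>). Conversely, a double power series with bounded terms at every point of
  the ball converges absolutely and is holomorphic there, by comparison with a geometric series on a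
  slightly larger polydisc (\<open>polydisc_majorant\<close>, \<open>power_series_has_derivative\<close>). The boundedness
  condition is visibly inherited when coefficients are deleted, so the projected series meets it too.
\<close>

section \<open>Double power series with bounded terms\<close>

lemma norm_complex2: "norm (z :: complex^2) = sqrt ((norm (z $ 1))\<^sup>2 + (norm (z $ 2))\<^sup>2)"
  by (simp add: norm_vec_def L2_set_def UNIV_2)

lemma summable_on_product:
  fixes u v :: "nat \<Rightarrow> real"
  assumes "summable u" "summable v" "\<And>n. 0 \<le> u n" "\<And>n. 0 \<le> v n"
  shows "(\<lambda>(a, b). u a * v b) summable_on UNIV"
proof -
  have "(\<lambda>(a, b). u a * v b) summable_on (SIGMA a:UNIV. UNIV)"
  proof (rule summable_on_SigmaI)
    have "v summable_on UNIV" using assms by (intro summable_nonneg_imp_summable_on)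
    then show "((\<lambda>b. case (a, b) of (a, b) \<Rightarrow> u a * v b) has_sum (u a * infsum v UNIV)) UNIV" for a
      by (simp add: has_sum_cmult_right)
    show "(\<lambda>a. u a * infsum v UNIV) summable_on UNIV"
      using assms by (intro summable_on_cmult_left summable_nonneg_imp_summable_on)
  qed (use assms in auto)
  then show ?thesis by simp
qed

lemma summable_Suc_mult_power:
  fixes t :: real
  assumes "0 \<le> t" "t < 1"
  shows "summable (\<lambda>n. real (Suc n) * t ^ n)"
  using geometric_deriv_sums[of t] assms by (auto simp: sums_iff)

text \<open>The ball is not a polydisc, so geometric comparison at a point needs a polydisc that contains the
  point in its interior while its corner still lies in the ball.\<close>

lemma polydisc_around_point:
  fixes z :: "complex^2"
  assumes "norm z < 1"
  obtains e where "e > 0"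
    "norm (vector [of_real (norm (z $ 1) + e), of_real (norm (z $ 2) + e)] :: complex^2) < 1"
proof -
  \<comment> \<open>Any \<open>e\<close> with \<open>2 * e < 1 - norm z\<close> would do, as the displacement has norm at most \<open>2 * e\<close>.\<close>
  define e where "e = (1 - norm z) / 4"
  have e: "e > 0" using assms by (simp add: e_def)
  let ?u = "vector [of_real (norm (z $ 1)), of_real (norm (z $ 2))] :: complex^2"
  let ?v = "vector [of_real e, of_real e] :: complex^2"
  have "vector [of_real (norm (z $ 1) + e), of_real (norm (z $ 2) + e)] = ?u + ?v"
    by (simp add: vec_eq_iff forall_2 vector_2)
  moreover have "norm ?u = norm z" by (simp add: norm_complex2 vector_2)
  moreover have "norm ?v \<le> 2 * e"
    using e by (auto simp: norm_complex2 vector_2 power2_eq_square intro!: real_le_lsqrt)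
  ultimately have "norm (vector [of_real (norm (z $ 1) + e), of_real (norm (z $ 2) + e)] :: complex^2)
      \<le> norm z + 2 * e"
    using norm_triangle_ineq[of ?u ?v] by simp
  also have "\<dots> < 1" using assms by (simp add: e_def field_simps)
  finally show ?thesis using e that by blast
qed

text \<open>One majorant serves the terms and both partial derivatives, uniformly on a polydisc. If the
  terms are at most \<open>M\<close> at the corner \<open>w\<close> of a larger polydisc, then \<open>\<bar>c\<^sub>a\<^sub>b\<bar> \<le> M / (w\<^sub>1\<^sup>a w\<^sub>2\<^sup>b)\<close>; the factor \<open>a\<close> or \<open>b\<close> that
  differentiation produces is absorbed by the series \<open>\<Sum>(n + 1) t\<^sup>n\<close>, which still converges for \<open>t < 1\<close>.\<close>

lemma polydisc_majorant:
  fixes c :: "nat \<times> nat \<Rightarrow> complex" and z :: "complex^2"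
  assumes bounded: "\<And>z. norm z < 1 \<Longrightarrow> \<exists>M. \<forall>\<alpha>. norm (c \<alpha> * monomial2 \<alpha> z) \<le> M"
    and "norm z < 1"
  obtains s1 s2 K where "norm (z $ 1) < s1" "norm (z $ 2) < s2" "K summable_on UNIV"
    "\<And>a b x y. norm x \<le> s1 \<Longrightarrow> norm y \<le> s2 \<Longrightarrow> norm (c (a, b) * x ^ a * y ^ b) \<le> K (a, b)"
    "\<And>a b x y. norm x \<le> s1 \<Longrightarrow> norm y \<le> s2 \<Longrightarrow>
       norm (c (a, b) * (of_nat a * x ^ (a - 1) * y ^ b)) \<le> K (a, b)"
    "\<And>a b x y. norm x \<le> s1 \<Longrightarrow> norm y \<le> s2 \<Longrightarrow>
       norm (c (a, b) * (x ^ a * (of_nat b * y ^ (b - 1)))) \<le> K (a, b)"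
proof -
  obtain e where e: "e > 0"
    and w: "norm (vector [of_real (norm (z $ 1) + e), of_real (norm (z $ 2) + e)] :: complex^2) < 1"
    using polydisc_around_point[OF \<open>norm z < 1\<close>] by blast
  define w1 w2 s1 s2 where "w1 = norm (z $ 1) + e" and "w2 = norm (z $ 2) + e"
    and "s1 = norm (z $ 1) + e / 2" and "s2 = norm (z $ 2) + e / 2"
  have s: "0 < s1" "s1 < w1" "0 < s2" "s2 < w2"
    using e by (auto simp: s1_def s2_def w1_def w2_def intro: add_nonneg_pos)
  from bounded[OF w] obtain M where M: "\<And>a b. norm (c (a, b)) * (w1 ^ a * w2 ^ b) \<le> M"
    using s by (auto simp: monomial2_def vector_2 norm_mult norm_power simp flip: w1_def w2_def of_real_add)
  have "0 \<le> M" using M[of 0 0] by (simp add: order_trans[OF norm_ge_zero])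
  define t1 t2 where "t1 = s1 / w1" and "t2 = s2 / w2"
  have t: "0 \<le> t1" "t1 < 1" "0 \<le> t2" "t2 < 1" using s by (auto simp: t1_def t2_def)
  define C where "C = M * (1 + 1 / s1 + 1 / s2)"
  define K where "K = (\<lambda>(a, b). C * ((real (Suc a) * t1 ^ a) * (real (Suc b) * t2 ^ b)))"
  have K: "m * (norm (c (a, b)) * (s1 ^ a * s2 ^ b)) \<le> K (a, b)"
    if "0 \<le> m" "m \<le> (1 + 1 / s1 + 1 / s2) * (real (Suc a) * real (Suc b))" for m a b
  proof -
    have "norm (c (a, b)) * (s1 ^ a * s2 ^ b)
        = (norm (c (a, b)) * (w1 ^ a * w2 ^ b)) * (t1 ^ a * t2 ^ b)"
      using s by (simp add: t1_def t2_def power_divide field_simps)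
    also have "\<dots> \<le> M * (t1 ^ a * t2 ^ b)"
      using t by (intro mult_right_mono M) auto
    finally have "m * (norm (c (a, b)) * (s1 ^ a * s2 ^ b))
        \<le> ((1 + 1 / s1 + 1 / s2) * (real (Suc a) * real (Suc b))) * (M * (t1 ^ a * t2 ^ b))"
      by (rule mult_mono[OF that(2)]) (use s t in auto)
    then show ?thesis by (simp add: K_def C_def mult_ac)
  qed
  have deriv_power: "norm (of_nat a * x ^ (a - 1)) \<le> real (Suc a) * (s ^ a / s)"
    if "norm x \<le> s" "0 < s" for a and x :: complex and s :: real
  proof (cases a)
    case (Suc n)
    with that show ?thesis
      by (auto simp: norm_mult norm_power simp del: of_nat_Suc intro!: mult_mono power_mono)
  qed (use that in auto)
  have "K summable_on UNIV"
    unfolding K_def case_prod_unfold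
    using summable_on_product[OF summable_Suc_mult_power summable_Suc_mult_power, of t1 t2] t
    by (intro summable_on_cmult_right) (auto simp: case_prod_unfold)
  moreover have "norm (c (a, b) * x ^ a * y ^ b) \<le> K (a, b)"
    if "norm x \<le> s1" "norm y \<le> s2" for a b x y
  proof -
    have "norm (c (a, b) * x ^ a * y ^ b) \<le> 1 * (norm (c (a, b)) * (s1 ^ a * s2 ^ b))"
      using that s by (auto simp: norm_mult norm_power mult.assoc intro!: mult_left_mono mult_mono power_mono)
    also have "1 \<le> (1 + 1 / s1 + 1 / s2) * (real (Suc a) * real (Suc b))"
      using s mult_mono[of 1 "1 + 1 / s1 + 1 / s2" 1 "real (Suc a) * real (Suc b)"]
        mult_mono[of 1 "real (Suc a)" 1 "real (Suc b)"] by simp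
    then have "1 * (norm (c (a, b)) * (s1 ^ a * s2 ^ b)) \<le> K (a, b)"
      by (intro K) auto
    finally show ?thesis .
  qed
  moreover have "norm (c (a, b) * (of_nat a * x ^ (a - 1) * y ^ b)) \<le> K (a, b)"
    if "norm x \<le> s1" "norm y \<le> s2" for a b x y
  proof -
    have "norm (c (a, b) * (of_nat a * x ^ (a - 1) * y ^ b))
        = norm (c (a, b)) * (norm (of_nat a * x ^ (a - 1)) * norm y ^ b)"
      by (simp add: norm_mult norm_power)
    also have "\<dots> \<le> norm (c (a, b)) * ((real (Suc a) * (s1 ^ a / s1)) * s2 ^ b)"
      using that s by (intro mult_left_mono mult_mono deriv_power power_mono) auto
    also have "\<dots> = (real (Suc a) / s1) * (norm (c (a, b)) * (s1 ^ a * s2 ^ b))"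
      using s by (simp add: field_simps)
    also have "\<dots> \<le> K (a, b)"
    proof (rule K)
      have "real (Suc a) / s1 = (1 / s1) * (real (Suc a) * 1)" by simp
      also have "\<dots> \<le> (1 + 1 / s1 + 1 / s2) * (real (Suc a) * real (Suc b))"
        using s by (intro mult_mono) auto
      finally show "real (Suc a) / s1 \<le> (1 + 1 / s1 + 1 / s2) * (real (Suc a) * real (Suc b))" .
    qed (use s in auto)
    finally show ?thesis .
  qed
  moreover have "norm (c (a, b) * (x ^ a * (of_nat b * y ^ (b - 1)))) \<le> K (a, b)"
    if "norm x \<le> s1" "norm y \<le> s2" for a b x y
  proof -
    have "norm (c (a, b) * (x ^ a * (of_nat b * y ^ (b - 1))))
        = norm (c (a, b)) * (norm x ^ a * norm (of_nat b * y ^ (b - 1)))"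
      by (simp add: norm_mult norm_power)
    also have "\<dots> \<le> norm (c (a, b)) * (s1 ^ a * (real (Suc b) * (s2 ^ b / s2)))"
      using that s by (intro mult_left_mono mult_mono deriv_power power_mono) auto
    also have "\<dots> = (real (Suc b) / s2) * (norm (c (a, b)) * (s1 ^ a * s2 ^ b))"
      using s by (simp add: field_simps)
    also have "\<dots> \<le> K (a, b)"
    proof (rule K)
      have "real (Suc b) / s2 = (1 / s2) * (1 * real (Suc b))" by simp
      also have "\<dots> \<le> (1 + 1 / s1 + 1 / s2) * (real (Suc a) * real (Suc b))"
        using s by (intro mult_mono) auto
      finally show "real (Suc b) / s2 \<le> (1 + 1 / s1 + 1 / s2) * (real (Suc a) * real (Suc b))" .
    qed (use s in auto)
    finally show ?thesis .
  qed
  ultimately show ?thesis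
    using that[of s1 s2 K] e by (simp add: s1_def s2_def)
qed

lemma power_series_summable:
  assumes bounded: "\<And>z. norm z < 1 \<Longrightarrow> \<exists>M. \<forall>\<alpha>. norm (c \<alpha> * monomial2 \<alpha> z) \<le> M"
    and "norm z < 1"
  shows "(\<lambda>\<alpha>. c \<alpha> * monomial2 \<alpha> z) summable_on UNIV"
proof -
  obtain s1 s2 K where K: "norm (z $ 1) < s1" "norm (z $ 2) < s2" "K summable_on UNIV"
    "\<And>a b x y. norm x \<le> s1 \<Longrightarrow> norm y \<le> s2 \<Longrightarrow> norm (c (a, b) * x ^ a * y ^ b) \<le> K (a, b)"
    using polydisc_majorant[OF assms] by metis
  have "norm (c \<alpha> * monomial2 \<alpha> z) \<le> K \<alpha>" for \<alpha>
  proof -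
    obtain a b where \<alpha>: "\<alpha> = (a, b)" by fastforce
    show ?thesis
      using K(4)[of "z $ 1" "z $ 2" a b] K(1,2) by (simp add: \<alpha> monomial2_def mult.assoc)
  qed
  then show ?thesis
    by (rule abs_summable_summable[OF Infinite_Sum.abs_summable_on_comparison_test'[OF K(3)]])
qed

text \<open>Termwise differentiation: the majorant gives uniform convergence of the differentiated series.
  The double series is enumerated by a bijection with the naturals because the theorem on derivatives
  of series is about sequences.\<close>

lemma has_derivative_infsum_majorised:
  fixes f :: "nat \<times> nat \<Rightarrow> complex^2 \<Rightarrow> complex" and p q :: "complex^2 \<Rightarrow> nat \<times> nat \<Rightarrow> complex"
  assumes "convex S" "open S" "z \<in> S" and K: "K summable_on UNIV"
    and f: "\<And>x \<alpha>. x \<in> S \<Longrightarrow> norm (f \<alpha> x) \<le> K \<alpha>"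
    and p: "\<And>x \<alpha>. x \<in> S \<Longrightarrow> norm (p x \<alpha>) \<le> K \<alpha>"
    and q: "\<And>x \<alpha>. x \<in> S \<Longrightarrow> norm (q x \<alpha>) \<le> K \<alpha>"
    and deriv: "\<And>x \<alpha>. x \<in> S \<Longrightarrow>
      (f \<alpha> has_derivative (\<lambda>h. p x \<alpha> * h $ 1 + q x \<alpha> * h $ 2)) (at x)"
  shows "((\<lambda>x. \<Sum>\<^sub>\<infinity>\<alpha>. f \<alpha> x) has_derivative
    (\<lambda>h. infsum (p z) UNIV * h $ 1 + infsum (q z) UNIV * h $ 2)) (at z)"
proof -
  have sums: "(\<lambda>n. g (prod_decode n)) sums infsum g UNIV"
    if g: "\<And>\<alpha>. norm (g \<alpha>) \<le> K \<alpha>" for g :: "nat \<times> nat \<Rightarrow> complex"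
  proof -
    have "g summable_on UNIV"
      by (rule abs_summable_summable[OF Infinite_Sum.abs_summable_on_comparison_test'[OF K g]])
    then have "(g has_sum infsum g UNIV) UNIV" by (rule has_sum_infsum)
    then have "((\<lambda>n. g (prod_decode n)) has_sum infsum g UNIV) UNIV"
      by (simp only: has_sum_reindex_bij_betw[OF bij_prod_decode, of g])
    then show ?thesis by (rule has_sum_imp_sums)
  qed
  have "(\<lambda>n. K (prod_decode n)) summable_on UNIV"
    using K by (simp only: summable_on_reindex_bij_betw[OF bij_prod_decode, of K])
  then have summable_K: "summable (\<lambda>n. K (prod_decode n))" by (rule summable_on_imp_summable)
  have unif: "uniform_limit S (\<lambda>n x. \<Sum>i<n. g x (prod_decode i)) (\<lambda>x. infsum (g x) UNIV) sequentially"
    if g: "\<And>x \<alpha>. x \<in> S \<Longrightarrow> norm (g x \<alpha>) \<le> K \<alpha>" for g :: "complex^2 \<Rightarrow> nat \<times> nat \<Rightarrow> complex"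
  proof -
    have "uniform_limit S (\<lambda>n x. \<Sum>i<n. g x (prod_decode i)) (\<lambda>x. \<Sum>i. g x (prod_decode i)) sequentially"
      by (rule Weierstrass_m_test[OF g summable_K])
    moreover have "(\<Sum>i. g x (prod_decode i)) = infsum (g x) UNIV" if "x \<in> S" for x
      by (rule sums_unique[symmetric, OF sums[OF g[OF that]]])
    ultimately show ?thesis
      by (simp cong: uniform_limit_cong')
  qed
  have "\<exists>g. \<forall>x\<in>S. (\<lambda>n. f (prod_decode n) x) sums g x \<and>
     (g has_derivative (\<lambda>h. infsum (p x) UNIV * h $ 1 + infsum (q x) UNIV * h $ 2)) (at x within S)"
  proof (rule has_derivative_series[where f = "\<lambda>n. f (prod_decode n)" and x = z
        and f' = "\<lambda>n x h. p x (prod_decode n) * h $ 1 + q x (prod_decode n) * h $ 2"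
        and g' = "\<lambda>x h. infsum (p x) UNIV * h $ 1 + infsum (q x) UNIV * h $ 2"])
    show "(f (prod_decode n) has_derivative
        (\<lambda>h. p x (prod_decode n) * h $ 1 + q x (prod_decode n) * h $ 2)) (at x within S)"
      if "x \<in> S" for n x
      by (rule has_derivative_at_withinI[OF deriv[OF that]])
    show "\<forall>\<^sub>F n in sequentially. \<forall>x\<in>S. \<forall>h :: complex^2. norm ((\<Sum>i<n. p x (prod_decode i) * h $ 1
         + q x (prod_decode i) * h $ 2) - (infsum (p x) UNIV * h $ 1 + infsum (q x) UNIV * h $ 2))
         \<le> e * norm h" if "e > 0" for e
    proof -
      have "e / 2 > 0" using that by simp
      have P: "\<forall>\<^sub>F n in sequentially. \<forall>x\<in>S. dist (\<Sum>i<n. p x (prod_decode i)) (infsum (p x) UNIV) < e / 2"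
        by (rule uniform_limitD[OF unif \<open>e / 2 > 0\<close>]) (rule p)
      have Q: "\<forall>\<^sub>F n in sequentially. \<forall>x\<in>S. dist (\<Sum>i<n. q x (prod_decode i)) (infsum (q x) UNIV) < e / 2"
        by (rule uniform_limitD[OF unif \<open>e / 2 > 0\<close>]) (rule q)
      have bound: "norm ((\<Sum>i<n. p x (prod_decode i) * h $ 1 + q x (prod_decode i) * h $ 2)
             - (infsum (p x) UNIV * h $ 1 + infsum (q x) UNIV * h $ 2)) \<le> e * norm h"
        if A: "dist (\<Sum>i<n. p x (prod_decode i)) (infsum (p x) UNIV) < e / 2"
          and B: "dist (\<Sum>i<n. q x (prod_decode i)) (infsum (q x) UNIV) < e / 2"
        for n x and h :: "complex^2"
      proof -
        define A B where "A = (\<Sum>i<n. p x (prod_decode i)) - infsum (p x) UNIV"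
          and "B = (\<Sum>i<n. q x (prod_decode i)) - infsum (q x) UNIV"
        have AB: "norm A \<le> e / 2" "norm B \<le> e / 2"
          using A B by (simp_all add: A_def B_def dist_norm less_imp_le)
        have "(\<Sum>i<n. p x (prod_decode i) * h $ 1 + q x (prod_decode i) * h $ 2)
             - (infsum (p x) UNIV * h $ 1 + infsum (q x) UNIV * h $ 2) = A * h $ 1 + B * h $ 2"
          by (simp add: A_def B_def sum.distrib sum_distrib_right left_diff_distrib)
        moreover have "norm (A * h $ 1 + B * h $ 2) \<le> norm A * norm (h $ 1) + norm B * norm (h $ 2)"
          by (rule norm_triangle_le) (simp add: norm_mult)
        moreover have "norm A * norm (h $ 1) + norm B * norm (h $ 2) \<le> e / 2 * norm h + e / 2 * norm h"
          using AB \<open>e > 0\<close>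
          by (intro add_mono mult_mono Finite_Cartesian_Product.norm_nth_le) simp_all
        ultimately show ?thesis by simp
      qed
      show ?thesis
        by (rule eventually_mono[OF eventually_conj[OF P Q]]) (use bound in blast)
    qed
    show "(\<lambda>n. f (prod_decode n) z) sums (\<Sum>\<^sub>\<infinity>\<alpha>. f \<alpha> z)"
      by (rule sums[OF f[OF \<open>z \<in> S\<close>]])
  qed (use assms in auto)
  then obtain g where g: "\<And>x. x \<in> S \<Longrightarrow> (\<lambda>n. f (prod_decode n) x) sums g x"
    and g': "\<And>x. x \<in> S \<Longrightarrow> (g has_derivative
       (\<lambda>h. infsum (p x) UNIV * h $ 1 + infsum (q x) UNIV * h $ 2)) (at x within S)"
    by blast
  have eq: "g x = (\<Sum>\<^sub>\<infinity>\<alpha>. f \<alpha> x)" if "x \<in> S" for x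
    by (rule sums_unique2[OF g[OF that] sums[OF f[OF that]]])
  have "(g has_derivative (\<lambda>h. infsum (p z) UNIV * h $ 1 + infsum (q z) UNIV * h $ 2)) (at z)"
    using g'[OF \<open>z \<in> S\<close>] by (simp add: at_within_open[OF \<open>z \<in> S\<close> \<open>open S\<close>])
  then show ?thesis
    by (rule has_derivative_transform_within_open[OF _ \<open>open S\<close> \<open>z \<in> S\<close> eq])
qed

lemma monomial2_has_derivative:
  "((\<lambda>x. c * monomial2 (a, b) x) has_derivative
     (\<lambda>h. c * (of_nat a * (z $ 1) ^ (a - 1) * (z $ 2) ^ b) * h $ 1
        + c * ((z $ 1) ^ a * (of_nat b * (z $ 2) ^ (b - 1))) * h $ 2)) (at z)"
proof -
  have coord: "((\<lambda>x :: complex^2. x $ i) has_derivative (\<lambda>h. h $ i)) (at z)" for i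
    by (rule bounded_linear_imp_has_derivative[OF bounded_linear_vec_nth])
  have "((\<lambda>x. c * ((x $ 1) ^ a * (x $ 2) ^ b)) has_derivative
     (\<lambda>h. c * ((z $ 1) ^ a * (of_nat b * h $ 2 * (z $ 2) ^ (b - 1))
        + of_nat a * h $ 1 * (z $ 1) ^ (a - 1) * (z $ 2) ^ b))) (at z)"
    by (intro has_derivative_mult_right has_derivative_mult has_derivative_power coord)
  then show ?thesis
    by (simp add: monomial2_def algebra_simps)
qed

lemma power_series_has_derivative:
  fixes c :: "nat \<times> nat \<Rightarrow> complex"
  assumes bounded: "\<And>z. norm z < 1 \<Longrightarrow> \<exists>M. \<forall>\<alpha>. norm (c \<alpha> * monomial2 \<alpha> z) \<le> M"
    and "norm z < 1"
  shows "((\<lambda>z. \<Sum>\<^sub>\<infinity>\<alpha>. c \<alpha> * monomial2 \<alpha> z) has_derivative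
     (\<lambda>h. (\<Sum>\<^sub>\<infinity>(a, b). c (a, b) * (of_nat a * (z $ 1) ^ (a - 1) * (z $ 2) ^ b)) * h $ 1
        + (\<Sum>\<^sub>\<infinity>(a, b). c (a, b) * ((z $ 1) ^ a * (of_nat b * (z $ 2) ^ (b - 1)))) * h $ 2)) (at z)"
proof -
  obtain s1 s2 K where z: "norm (z $ 1) < s1" "norm (z $ 2) < s2" and K: "K summable_on UNIV"
    "\<And>a b x y. norm x \<le> s1 \<Longrightarrow> norm y \<le> s2 \<Longrightarrow> norm (c (a, b) * x ^ a * y ^ b) \<le> K (a, b)"
    "\<And>a b x y. norm x \<le> s1 \<Longrightarrow> norm y \<le> s2 \<Longrightarrow>
       norm (c (a, b) * (of_nat a * x ^ (a - 1) * y ^ b)) \<le> K (a, b)"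
    "\<And>a b x y. norm x \<le> s1 \<Longrightarrow> norm y \<le> s2 \<Longrightarrow>
       norm (c (a, b) * (x ^ a * (of_nat b * y ^ (b - 1)))) \<le> K (a, b)"
    using polydisc_majorant[OF assms] by blast
  define S where "S = {x :: complex^2. norm (x $ 1) < s1 \<and> norm (x $ 2) < s2}"
  have "S = (\<lambda>x. x $ 1) -` ball 0 s1 \<inter> (\<lambda>x. x $ 2) -` ball 0 s2"
    by (auto simp: S_def)
  moreover have "convex ((\<lambda>x :: complex^2. x $ i) -` ball 0 s)" for i s
    by (rule convex_linear_vimage[OF bounded_linear.linear[OF bounded_linear_vec_nth] convex_ball])
  ultimately have "convex S" by (simp add: convex_Int)
  have "open S"
    unfolding S_def by (intro open_Collect_conj open_Collect_less continuous_intros)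
  define p q where "p x = (\<lambda>(a, b). c (a, b) * (of_nat a * (x $ 1) ^ (a - 1) * (x $ 2) ^ b))"
    and "q x = (\<lambda>(a, b). c (a, b) * ((x $ 1) ^ a * (of_nat b * (x $ 2) ^ (b - 1))))"
    for x :: "complex^2"
  have "((\<lambda>x. \<Sum>\<^sub>\<infinity>\<alpha>. c \<alpha> * monomial2 \<alpha> x) has_derivative
      (\<lambda>h. infsum (p z) UNIV * h $ 1 + infsum (q z) UNIV * h $ 2)) (at z)"
  proof (rule has_derivative_infsum_majorised[OF \<open>convex S\<close> \<open>open S\<close> _ K(1)])
    show "z \<in> S" using z by (simp add: S_def)
    fix x and \<alpha> :: "nat \<times> nat" assume x: "x \<in> S"
    obtain a b where \<alpha>: "\<alpha> = (a, b)" by fastforce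
    have s: "norm (x $ 1) \<le> s1" "norm (x $ 2) \<le> s2" using x by (simp_all add: S_def)
    show "norm (c \<alpha> * monomial2 \<alpha> x) \<le> K \<alpha>"
      using K(2)[OF s, of a b] by (simp add: \<alpha> monomial2_def mult.assoc)
    show "norm (p x \<alpha>) \<le> K \<alpha>" using K(3)[OF s, of a b] by (simp only: \<alpha> p_def prod.case)
    show "norm (q x \<alpha>) \<le> K \<alpha>" using K(4)[OF s, of a b] by (simp only: \<alpha> q_def prod.case)
    show "((\<lambda>z. c \<alpha> * monomial2 \<alpha> z) has_derivative (\<lambda>h. p x \<alpha> * h $ 1 + q x \<alpha> * h $ 2)) (at x)"
      unfolding \<alpha> p_def q_def prod.case by (rule monomial2_has_derivative)
  qed
  then show ?thesis unfolding p_def q_def .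
qed

section \<open>Taylor expansion along complex lines\<close>

lemma norm_smult_complex2: "norm (l *s (z :: complex^2)) = norm l * norm z"
proof -
  have "(norm l * norm (z $ 1))\<^sup>2 + (norm l * norm (z $ 2))\<^sup>2
      = (norm l)\<^sup>2 * ((norm (z $ 1))\<^sup>2 + (norm (z $ 2))\<^sup>2)"
    by (simp add: power_mult_distrib distrib_left)
  then show ?thesis
    by (simp add: norm_complex2 norm_mult real_sqrt_mult)
qed

lemma has_derivative_line: "((\<lambda>l. l *s (w :: complex^2)) has_derivative (\<lambda>h. h *s w)) (at l)"
proof -
  have "linear (\<lambda>l. l *s w)"
    by (rule linearI) (auto simp: vec_eq_iff algebra_simps)
  then show ?thesis
    by (simp add: linear_linear bounded_linear_imp_has_derivative)
qed

text \<open>The expansion is assumed only near 0, but that determines the coefficients of the Taylor series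
  on the whole disc of holomorphy.\<close>

lemma power_series_coeff_eq_deriv:
  fixes a :: "nat \<Rightarrow> complex"
  assumes "\<forall>\<^sub>F l in nhds 0. (\<lambda>n. a n * l ^ n) sums \<phi> l"
  shows "a n = (deriv ^^ n) \<phi> 0 / fact n"
proof -
  obtain e where e: "e > 0" "\<And>l. norm l < e \<Longrightarrow> (\<lambda>n. a n * l ^ n) sums \<phi> l"
    using assms by (auto simp: eventually_nhds_metric)
  have "conv_radius a \<ge> norm (of_real (e / 2) :: complex)"
    using e(2)[of "of_real (e/2)"] e(1) by (intro conv_radius_geI) (auto simp: sums_iff)
  then have "\<phi> has_fps_expansion (Abs_fps a)"
    unfolding has_fps_expansion_def fps_conv_radius_def
  proof safe
    show "0 < conv_radius (fps_nth (Abs_fps a))"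
      using \<open>conv_radius a \<ge> _\<close> e(1)
      by (simp add: fps_nth_Abs_fps) (metis abs_of_pos ereal_less(2) half_gt_zero less_le_trans e(1))
    show "\<forall>\<^sub>F z in nhds 0. eval_fps (Abs_fps a) z = \<phi> z"
      using assms by eventually_elim (simp add: eval_fps_def sums_iff)
  qed
  from fps_nth_fps_expansion[OF this, of n] show ?thesis by simp
qed

lemma power_series_Cauchy:
  fixes a :: "nat \<Rightarrow> complex"
  assumes "\<forall>\<^sub>F l in nhds 0. (\<lambda>n. a n * l ^ n) sums \<phi> l"
    and hol: "\<phi> holomorphic_on ball 0 R" and "R > 1"
  shows power_series_Cauchy_sums: "(\<lambda>n. a n) sums \<phi> 1"
    and power_series_Cauchy_bound: "(\<And>l. norm l = 1 \<Longrightarrow> norm (\<phi> l) \<le> M) \<Longrightarrow> norm (a n) \<le> M"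
proof -
  note coeff = power_series_coeff_eq_deriv[OF assms(1)]
  show "(\<lambda>n. a n) sums \<phi> 1"
    using holomorphic_power_series[OF hol, of 1] \<open>R > 1\<close> by (simp add: coeff)
  assume M: "\<And>l. norm l = 1 \<Longrightarrow> norm (\<phi> l) \<le> M"
  have "norm ((deriv ^^ n) \<phi> 0) \<le> fact n * M / 1 ^ n"
  proof (rule Cauchy_inequality)
    show "\<phi> holomorphic_on ball 0 1"
      by (rule holomorphic_on_subset[OF hol]) (use \<open>R > 1\<close> in auto)
    show "continuous_on (cball 0 1) \<phi>"
      by (rule holomorphic_on_imp_continuous_on[OF holomorphic_on_subset[OF hol]])
        (use \<open>R > 1\<close> in auto)
  qed (use M in auto)
  then show "norm (a n) \<le> M"
    by (simp add: coeff norm_divide divide_le_eq mult.commute)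
qed

lemma polynomial_coeff_bound:
  fixes b :: "nat \<Rightarrow> complex"
  assumes "\<And>l. norm l = 1 \<Longrightarrow> norm (\<Sum>k\<le>n. b k * l ^ k) \<le> M" and "k \<le> n"
  shows "norm (b k) \<le> M"
proof -
  define a where "a k = (if k \<le> n then b k else 0)" for k
  have "norm (a k) \<le> M"
  proof (rule power_series_Cauchy_bound)
    have "(\<lambda>k. a k * l ^ k) sums (\<Sum>k\<le>n. b k * l ^ k)" for l
      using sums_finite[of "{..n}" "\<lambda>k. a k * l ^ k"] by (simp add: a_def)
    then show "\<forall>\<^sub>F l in nhds 0. (\<lambda>k. a k * l ^ k) sums (\<Sum>k\<le>n. b k * l ^ k)"
      by simp
    show "(\<lambda>l. \<Sum>k\<le>n. b k * l ^ k) holomorphic_on ball 0 2"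
      by (intro holomorphic_intros)
  qed (use assms in auto)
  with \<open>k \<le> n\<close> show ?thesis by (simp add: a_def)
qed

lemma has_sum_diagonals:
  fixes g :: "nat \<times> nat \<Rightarrow> complex"
  assumes "(g has_sum s) UNIV"
  shows "(\<lambda>n. \<Sum>k\<le>n. g (n - k, k)) sums s"
proof -
  have "((\<lambda>(n, k). g (n - k, k)) has_sum s) (SIGMA n:UNIV. {..n})"
    using assms
    by (subst has_sum_reindex_bij_witness[where T = UNIV and h = g and s' = s
          and j = "\<lambda>(n, k). (n - k, k)" and i = "\<lambda>(a, k). (a + k, k)"]) auto
  then have "((\<lambda>n. \<Sum>k\<le>n. g (n - k, k)) has_sum s) UNIV"
    by (rule has_sum_SigmaD) (auto intro: has_sum_finiteI)
  then show ?thesis by (rule has_sum_imp_sums)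
qed

text \<open>The expansion is known near the origin only; the facts below extend it to the whole ball.\<close>

locale ball_expansion =
  fixes f :: "complex^2 \<Rightarrow> complex" and c :: "nat \<times> nat \<Rightarrow> complex"
  assumes hol: "\<And>z. norm z < 1 \<Longrightarrow> \<exists>p q. (f has_derivative (\<lambda>v. p * v $ 1 + q * v $ 2)) (at z)"
    and exp: "\<forall>\<^sub>F z in nhds 0. ((\<lambda>\<alpha>. c \<alpha> * monomial2 \<alpha> z) has_sum f z) UNIV"
begin

definition homogeneous_part :: "nat \<Rightarrow> complex^2 \<Rightarrow> complex" where
  "homogeneous_part n w = (\<Sum>k\<le>n. c (n - k, k) * monomial2 (n - k, k) w)"

lemma continuous_on_ball: "S \<subseteq> ball 0 1 \<Longrightarrow> continuous_on S f"
  using hol by (intro continuous_at_imp_continuous_on) (force dest: has_derivative_continuous)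

lemma slice_holomorphic:
  assumes "norm w < R" "0 < R"
  shows "(\<lambda>l. f (l *s w)) holomorphic_on ball 0 (1 / R)"
proof -
  have "(\<lambda>l. f (l *s w)) field_differentiable at l" if "norm l < 1 / R" for l
  proof -
    have "norm (l *s w) \<le> norm l * R"
      using assms by (simp add: norm_smult_complex2 mult_left_mono)
    also have "\<dots> < 1" using that \<open>0 < R\<close> by (simp add: field_simps)
    finally obtain p q where "(f has_derivative (\<lambda>v. p * v $ 1 + q * v $ 2)) (at (l *s w))"
      using hol by blast
    from has_derivative_compose[OF has_derivative_line this]
    have "((\<lambda>l. f (l *s w)) has_derivative (\<lambda>h. (p * w $ 1 + q * w $ 2) * h)) (at l)"
      by (simp add: algebra_simps)
    then have "((\<lambda>l. f (l *s w)) has_field_derivative (p * w $ 1 + q * w $ 2)) (at l)"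
      by (simp add: has_field_derivative_def)
    then show ?thesis by (auto simp: field_differentiable_def)
  qed
  then show ?thesis
    by (auto simp: holomorphic_on_def intro: field_differentiable_at_within)
qed

lemma slice_expansion:
  "\<forall>\<^sub>F l in nhds 0. (\<lambda>n. homogeneous_part n w * l ^ n) sums f (l *s w)"
proof -
  have "(\<lambda>l. l *s w) \<midarrow>0\<rightarrow> 0 *s w"
    using has_derivative_continuous[OF has_derivative_line[of w 0]] by (simp add: continuous_at)
  then have "filterlim (\<lambda>l. l *s w) (nhds 0) (nhds 0)"
    using tendsto_at_iff_tendsto_nhds[of "\<lambda>l. l *s w" 0] by simp
  from eventually_compose_filterlim[OF exp this] show ?thesis
  proof eventually_elim
    case (elim l)
    have "(\<Sum>k\<le>n. c (n - k, k) * monomial2 (n - k, k) (l *s w)) = homogeneous_part n w * l ^ n" for n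
      unfolding homogeneous_part_def sum_distrib_right
    proof (rule sum.cong)
      fix k assume "k \<in> {..n}"
      then have "l ^ n = l ^ (n - k) * l ^ k" by (simp flip: power_add)
      then show "c (n - k, k) * monomial2 (n - k, k) (l *s w)
          = c (n - k, k) * monomial2 (n - k, k) w * l ^ n"
        by (simp add: monomial2_def power_mult_distrib)
    qed simp
    with has_sum_diagonals[OF elim] show ?case by simp
  qed
qed

text \<open>Cauchy's inequality is used twice. On the slice \<open>l \<mapsto> f (l w)\<close> it bounds every homogeneous part
  by the maximum \<open>M\<close> of \<open>f\<close> over the closed ball of radius \<open>\<parallel>z\<parallel>\<close>. The homogeneous part at
  \<open>(z\<^sub>1, l z\<^sub>2)\<close> is a polynomial in \<open>l\<close> whose coefficients are the single terms at \<open>z\<close>, and these points have the same norm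
  as \<open>z\<close> when \<open>\<bar>l\<bar> = 1\<close>.\<close>

lemma terms_bounded:
  assumes "norm z < 1"
  shows "\<exists>M. \<forall>\<alpha>. norm (c \<alpha> * monomial2 \<alpha> z) \<le> M"
proof -
  obtain R where R: "norm z < R" "R < 1" using assms dense by blast
  then have "0 < R" using norm_ge_zero le_less_trans by blast
  have "compact (f ` cball 0 (norm z))"
    using assms by (intro compact_continuous_image continuous_on_ball) auto
  then obtain M where "\<forall>w\<in>cball 0 (norm z). norm (f w) \<le> M"
    by (auto dest!: compact_imp_bounded simp: bounded_iff)
  then have M: "norm (f w) \<le> M" if "norm w \<le> norm z" for w
    using that by simp
  have hom: "norm (homogeneous_part n w) \<le> M" if "norm w \<le> norm z" for n w
    using slice_expansion slice_holomorphic[of w R] that R \<open>0 < R\<close>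
    by (intro power_series_Cauchy_bound) (auto simp: norm_smult_complex2 intro!: M)
  have "norm (c (a, k) * monomial2 (a, k) z) \<le> M" for a k
  proof (rule polynomial_coeff_bound[where n = "a + k"
        and b = "\<lambda>k'. c (a + k - k', k') * monomial2 (a + k - k', k') z" and k = k, simplified])
    fix l :: complex assume l: "norm l = 1"
    have "norm (vector [z $ 1, l * z $ 2] :: complex^2) = norm z"
      by (simp add: norm_complex2 vector_2 norm_mult l)
    with hom[of "vector [z $ 1, l * z $ 2]" "a + k"]
    show "norm (\<Sum>k'\<le>a + k. c (a + k - k', k') * monomial2 (a + k - k', k') z * l ^ k') \<le> M"
      by (simp add: homogeneous_part_def monomial2_def vector_2 power_mult_distrib mult_ac)
  qed
  then show ?thesis by auto
qed

lemma sums_homogeneous_parts: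
  assumes "norm z < 1"
  shows "(\<lambda>n. homogeneous_part n z) sums f z"
proof -
  obtain R where R: "norm z < R" "R < 1" using assms dense by blast
  then have "0 < R" using norm_ge_zero le_less_trans by blast
  then show ?thesis
    using power_series_Cauchy_sums[OF slice_expansion slice_holomorphic[OF R(1)]] R by simp
qed

lemma has_sum_on_ball:
  assumes "norm z < 1"
  shows "((\<lambda>\<alpha>. c \<alpha> * monomial2 \<alpha> z) has_sum f z) UNIV"
proof -
  obtain s where s: "((\<lambda>\<alpha>. c \<alpha> * monomial2 \<alpha> z) has_sum s) UNIV"
    using power_series_summable[OF terms_bounded assms] by (auto simp: summable_on_def)
  have "f z = s"
    using has_sum_diagonals[OF s] sums_homogeneous_parts[OF assms]
    unfolding homogeneous_part_def by (rule sums_unique2[symmetric])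
  with s show ?thesis by simp
qed

end

section \<open>Averages over roots of unity\<close>

lemma root_of_unity_average:
  fixes m :: int and N :: nat
  assumes "\<bar>m\<bar> < int N"
  shows "(\<Sum>j<N. cis (of_int m * (2 * pi * real j / real N))) / of_nat N = (if m = 0 then 1 else 0)"
proof (cases "m = 0")
  case True
  then show ?thesis using assms by simp
next
  case False
  define \<omega> where "\<omega> = cis (2 * pi * of_int m / real N)"
  have "N > 0" using assms by simp
  have "\<omega> \<noteq> 1"
  proof
    assume "\<omega> = 1"
    then obtain n :: int where "2 * pi * of_int m / real N = of_int (2 * n) * pi"
      by (auto simp: \<omega>_def cis_conv_exp exp_eq_1)
    then have "real_of_int m = of_int (n * int N)"
      using \<open>N > 0\<close> by (simp add: field_simps)
    then have "m = n * int N" by (simp only: of_int_eq_iff)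
    with \<open>m \<noteq> 0\<close> assms show False
      using zdvd_imp_le[of "int N" "\<bar>m\<bar>"] by auto
  qed
  moreover have "\<omega> ^ N = 1"
    unfolding \<omega>_def Complex.DeMoivre using \<open>N > 0\<close> by simp
  moreover have "cis (of_int m * (2 * pi * real j / real N)) = \<omega> ^ j" for j
    unfolding \<omega>_def Complex.DeMoivre by (rule arg_cong[of _ _ cis]) simp
  ultimately show ?thesis using False by (simp add: geometric_sum)
qed

lemma has_sum_sum:
  fixes f :: "'j \<Rightarrow> 'i \<Rightarrow> complex"
  assumes "finite J" "\<And>j. j \<in> J \<Longrightarrow> (f j has_sum s j) A"
  shows "((\<lambda>i. \<Sum>j\<in>J. f j i) has_sum (\<Sum>j\<in>J. s j)) A"
  using assms by (induction J rule: finite_induct) (auto intro: has_sum_add)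

text \<open>The circle mean of \<open>\<phi>\<close> is its constant Fourier coefficient. Once \<open>N\<close> exceeds all frequencies
  in a finite set \<open>F\<close> of indices, the discrete mean treats the terms in \<open>F\<close> exactly, and each of the others
  contributes an error of at most \<open>\<bar>a i\<bar>\<close>, because a mean of unimodular numbers lies in the unit disc.
  Aliasing (nonzero frequencies divisible by \<open>N\<close>) only happens outside \<open>F\<close>.\<close>

lemma circle_average_tendsto:
  fixes a :: "'i \<Rightarrow> complex" and m :: "'i \<Rightarrow> int" and \<phi> :: "real \<Rightarrow> complex"
  assumes \<phi>: "\<And>t. ((\<lambda>i. a i * cis (of_int (m i) * t)) has_sum \<phi> t) UNIV"
    and s: "((\<lambda>i. if m i = 0 then a i else 0) has_sum s) UNIV"
  shows "(\<lambda>N. (\<Sum>j<N. \<phi> (2 * pi * real j / real N)) / of_nat N) \<longlonglongrightarrow> s"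
proof (rule LIMSEQ_I)
  fix \<epsilon> :: real assume "\<epsilon> > 0"
  have "a summable_on UNIV" using \<phi>[of 0] by (auto simp: summable_on_def)
  then have norm_a: "(\<lambda>i. norm (a i)) summable_on UNIV"
    by (simp add: summable_on_iff_abs_summable_on_complex)
  obtain F where F: "finite F"
    and tail: "dist (\<Sum>i\<in>F. norm (a i)) (\<Sum>\<^sub>\<infinity>i. norm (a i)) \<le> \<epsilon> / 2"
    using infsum_finite_approximation[OF norm_a, of "\<epsilon> / 2"] \<open>\<epsilon> > 0\<close> by auto
  let ?e = "\<lambda>N k. (\<Sum>j<N. cis (of_int k * (2 * pi * real j / real N))) / of_nat N"
  have "norm ((\<Sum>j<N. \<phi> (2 * pi * real j / real N)) / of_nat N - s) < \<epsilon>"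
    if "N > 0" and N: "\<And>i. i \<in> F \<Longrightarrow> \<bar>m i\<bar> < int N" for N
  proof -
    have "((\<lambda>i. (\<Sum>j<N. a i * cis (of_int (m i) * (2 * pi * real j / real N))) / of_nat N) has_sum
        (\<Sum>j<N. \<phi> (2 * pi * real j / real N)) / of_nat N) UNIV"
      by (intro has_sum_divide_const has_sum_sum \<phi> finite_lessThan)
    note has_sum_add[OF this has_sum_uminusI[OF s]]
    moreover have "a i * x + - (if m i = 0 then a i else 0) = a i * (x - (if m i = 0 then 1 else 0))"
      for i and x :: complex
      by (simp add: right_diff_distrib)
    ultimately have diff: "((\<lambda>i. a i * (?e N (m i) - (if m i = 0 then 1 else 0))) has_sum
        ((\<Sum>j<N. \<phi> (2 * pi * real j / real N)) / of_nat N - s)) UNIV"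
      by (simp only: sum_distrib_left[symmetric] times_divide_eq_right[symmetric] diff_conv_add_uminus)
    have "((\<lambda>i. norm (a i)) has_sum (\<Sum>\<^sub>\<infinity>i. norm (a i)) - (\<Sum>i\<in>F. norm (a i))) (UNIV - F)"
      using has_sum_Diff[OF has_sum_infsum[OF norm_a] has_sum_finiteI[OF F refl]] by simp
    then have "((\<lambda>i. if i \<in> F then 0 else norm (a i)) has_sum
        (\<Sum>\<^sub>\<infinity>i. norm (a i)) - (\<Sum>i\<in>F. norm (a i))) UNIV"
      by (rule has_sum_cong_neutral[THEN iffD1, rotated -1]) auto
    with diff have "norm ((\<Sum>j<N. \<phi> (2 * pi * real j / real N)) / of_nat N - s)
        \<le> (\<Sum>\<^sub>\<infinity>i. norm (a i)) - (\<Sum>i\<in>F. norm (a i))"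
    proof (rule norm_infsum_le)
      fix i
      have "norm (?e N k) \<le> 1" for k :: int
      proof -
        have "norm (\<Sum>j<N. cis (of_int k * (2 * pi * real j / real N))) \<le> real N"
          using norm_sum[of "\<lambda>j. cis (of_int k * (2 * pi * real j / N))" "{..<N}"] by simp
        then show ?thesis using \<open>N > 0\<close> by (simp add: norm_divide)
      qed
      moreover have "?e N 0 = 1" using \<open>N > 0\<close> by simp
      ultimately have "norm (?e N (m i) - (if m i = 0 then 1 else 0)) \<le> 1"
        by (cases "m i = 0") simp_all
      then have "norm (a i) * norm (?e N (m i) - (if m i = 0 then 1 else 0)) \<le> norm (a i)"
        by (simp add: mult_left_le)
      then show "norm (a i * (?e N (m i) - (if m i = 0 then 1 else 0)))
          \<le> (if i \<in> F then 0 else norm (a i))"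
        using root_of_unity_average[OF N] by (simp add: norm_mult)
    qed
    also have "\<dots> \<le> \<epsilon> / 2" using tail unfolding dist_real_def by linarith
    finally show ?thesis using \<open>\<epsilon> > 0\<close> by simp
  qed
  note close = this
  define B where "B = Max (insert 0 ((\<lambda>i. \<bar>m i\<bar>) ` F))"
  have B: "\<bar>m i\<bar> \<le> B" if "i \<in> F" for i
    unfolding B_def using F that by (intro Max_ge) auto
  show "\<exists>no. \<forall>N\<ge>no. norm ((\<Sum>j<N. \<phi> (2 * pi * real j / real N)) / of_nat N - s) < \<epsilon>"
  proof (intro exI allI impI)
    fix N assume "N \<ge> Suc (nat B)"
    then have "N > 0" "B < int N" by linarith+
    then show "norm ((\<Sum>j<N. \<phi> (2 * pi * real j / real N)) / of_nat N - s) < \<epsilon>"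
      by (intro close) (use B le_less_trans in blast)+
  qed
qed

lemma circle_average_Re_ge:
  fixes a b :: "'i \<Rightarrow> complex" and m k :: "'i \<Rightarrow> int" and \<phi> \<psi> :: "real \<Rightarrow> complex"
  assumes "\<And>t. ((\<lambda>i. a i * cis (of_int (m i) * t)) has_sum \<phi> t) UNIV"
    and "((\<lambda>i. if m i = 0 then a i else 0) has_sum s) UNIV"
    and "\<And>t. ((\<lambda>i. b i * cis (of_int (k i) * t)) has_sum \<psi> t) UNIV"
    and "((\<lambda>i. if k i = 0 then b i else 0) has_sum r) UNIV"
    and lower: "\<And>t. \<mu> \<le> Re (\<phi> t + \<psi> t)"
  shows "\<mu> \<le> Re (s + r)"
proof -
  let ?avg = "\<lambda>N. (\<Sum>j<N. \<phi> (2 * pi * real j / real N)) / of_nat N + (\<Sum>j<N. \<psi> (2 * pi * real j / real N)) / of_nat N"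
  have "(\<lambda>N. Re (?avg N)) \<longlonglongrightarrow> Re (s + r)"
    using assms by (intro tendsto_Re tendsto_add circle_average_tendsto)
  moreover have "\<mu> \<le> Re (?avg N)" if "N \<ge> 1" for N
  proof -
    have "real N * \<mu> \<le> (\<Sum>j<N. Re (\<phi> (2 * pi * real j / real N) + \<psi> (2 * pi * real j / real N)))"
      using sum_mono[of "{..<N}" "\<lambda>_. \<mu>", OF lower] by simp
    also have "\<dots> = real N * Re (?avg N)"
      using that by (simp add: sum.distrib add_divide_distrib distrib_left)
    finally show ?thesis using that by simp
  qed
  ultimately show ?thesis
    by (intro tendsto_lowerbound[where F = sequentially])
      (auto simp: eventually_sequentially)
qed

section \<open>Coefficients of a normalised vector field\<close>

text \<open>The coefficients of \<open>- z\<^sup>l + \<Sum>\<alpha>\<in>I. q \<alpha> z\<^sup>\<alpha>\<close> as a series over all multi-indices. Treating the linear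
  term as one more term is harmless for the projection: the linear monomial of
  each component has frequency 0 under the rotations.\<close>

definition field_coeff :: "nat \<times> nat \<Rightarrow> (nat \<times> nat \<Rightarrow> complex) \<Rightarrow> (nat \<times> nat) set \<Rightarrow> nat \<times> nat \<Rightarrow> complex" where
  "field_coeff l q I \<alpha> = (if \<alpha> = l then -1 else if \<alpha> \<in> I then q \<alpha> else 0)"

lemma has_sum_field_coeff:
  assumes "l \<notin> I" "((\<lambda>\<alpha>. q \<alpha> * monomial2 \<alpha> z) has_sum s) I"
  shows "((\<lambda>\<alpha>. field_coeff l q I \<alpha> * monomial2 \<alpha> z) has_sum (- monomial2 l z + s)) UNIV"
proof -
  have "((\<lambda>\<alpha>. field_coeff l q I \<alpha> * monomial2 \<alpha> z) has_sum s) I"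
    using assms by (subst has_sum_cong[of _ _ "\<lambda>\<alpha>. q \<alpha> * monomial2 \<alpha> z"]) (auto simp: field_coeff_def)
  from has_sum_insert[OF assms(1) this]
  have "((\<lambda>\<alpha>. field_coeff l q I \<alpha> * monomial2 \<alpha> z) has_sum (- monomial2 l z + s)) (insert l I)"
    by (simp add: field_coeff_def)
  then show ?thesis
    by (rule has_sum_cong_neutral[THEN iffD1, rotated -1]) (auto simp: field_coeff_def)
qed

lemma summable_on_of_field_coeff:
  assumes "l \<notin> I" "(\<lambda>\<alpha>. field_coeff l q I \<alpha> * monomial2 \<alpha> z) summable_on UNIV"
  shows "(\<lambda>\<alpha>. q \<alpha> * monomial2 \<alpha> z) summable_on I"
proof -
  have "(\<lambda>\<alpha>. field_coeff l q I \<alpha> * monomial2 \<alpha> z) summable_on I"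
    using assms(2) by (rule summable_on_subset) simp
  then show ?thesis
    by (rule summable_on_cong[THEN iffD1, rotated]) (use assms in \<open>auto simp: field_coeff_def\<close>)
qed

lemma infsum_partial_at_0:
  fixes c :: "nat \<times> nat \<Rightarrow> complex"
  shows "(\<Sum>\<^sub>\<infinity>(a, b). c (a, b) * (of_nat a * 0 ^ (a - 1) * 0 ^ b)) = c (1, 0)"
    and "(\<Sum>\<^sub>\<infinity>(a, b). c (a, b) * (0 ^ a * (of_nat b * 0 ^ (b - 1)))) = c (0, 1)"
proof -
  have "(\<Sum>\<^sub>\<infinity>(a, b). c (a, b) * (of_nat a * 0 ^ (a - 1) * 0 ^ b))
      = (\<Sum>\<^sub>\<infinity>(a, b)\<in>{(1, 0)}. c (a, b) * (of_nat a * 0 ^ (a - 1) * 0 ^ b))"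
    by (rule infsum_cong_neutral) (auto simp: power_0_left split: if_splits)
  then show "(\<Sum>\<^sub>\<infinity>(a, b). c (a, b) * (of_nat a * 0 ^ (a - 1) * 0 ^ b)) = c (1, 0)"
    by simp
  have "(\<Sum>\<^sub>\<infinity>(a, b). c (a, b) * (0 ^ a * (of_nat b * 0 ^ (b - 1))))
      = (\<Sum>\<^sub>\<infinity>(a, b)\<in>{(0, 1)}. c (a, b) * (0 ^ a * (of_nat b * 0 ^ (b - 1))))"
    by (rule infsum_cong_neutral) (auto simp: power_0_left split: if_splits)
  then show "(\<Sum>\<^sub>\<infinity>(a, b). c (a, b) * (0 ^ a * (of_nat b * 0 ^ (b - 1)))) = c (0, 1)"
    by simp
qed

section \<open>Componentwise derivatives\<close>

lemma has_derivative_vector2: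
  fixes f g :: "'a::real_normed_vector \<Rightarrow> complex"
  assumes "(f has_derivative f') (at z)" "(g has_derivative g') (at z)"
  shows "((\<lambda>x. vector [f x, g x] :: complex^2) has_derivative (\<lambda>h. vector [f' h, g' h])) (at z)"
proof -
  have "linear (\<lambda>(x, y). vector [x, y] :: complex^2)"
    by (rule linearI) (auto simp: vec_eq_iff forall_2 vector_2)
  then have "bounded_linear (\<lambda>(x, y). vector [x, y] :: complex^2)"
    by (simp add: linear_linear)
  from bounded_linear.has_derivative[OF this has_derivative_Pair[OF assms]]
  show ?thesis by simp
qed

lemma matrix2_vector_mult:
  "((vector [vector [a, b], vector [c, d]] :: complex^2^2) *v h)
    = vector [a * h $ 1 + b * h $ 2, c * h $ 1 + d * h $ 2]"
  by (simp add: vec_eq_iff forall_2 vector_2 matrix_vector_mult_def UNIV_2)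

lemma holomorphic_map_component:
  assumes "holomorphic_map_on G (ball 0 1)" "norm z < 1"
  shows "\<exists>p q. ((\<lambda>z. G z $ i) has_derivative (\<lambda>v. p * v $ 1 + q * v $ 2)) (at z)"
proof -
  obtain A :: "complex^2^2" where "(G has_derivative (\<lambda>v. A *v v)) (at z)"
    using assms unfolding holomorphic_map_on_def by fastforce
  from bounded_linear.has_derivative[OF bounded_linear_vec_nth this]
  show ?thesis by (auto simp: matrix_vector_mult_def UNIV_2)
qed

section \<open>Torus rotations\<close>

definition torus_rotation :: "int \<Rightarrow> int \<Rightarrow> real \<Rightarrow> complex^2 \<Rightarrow> complex^2" where
  "torus_rotation k1 k2 t z = vector [cis (k1 * t) * z $ 1, cis (k2 * t) * z $ 2]"

lemma monomial2_torus_rotation: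
  "monomial2 \<alpha> (torus_rotation k1 k2 t z)
    = monomial2 \<alpha> z * cis (of_int (int (fst \<alpha>) * k1 + int (snd \<alpha>) * k2) * t)"
proof -
  have "cis (of_int (int (fst \<alpha>) * k1 + int (snd \<alpha>) * k2) * t)
      = cis (k1 * t) ^ fst \<alpha> * cis (k2 * t) ^ snd \<alpha>"
    unfolding Complex.DeMoivre cis_mult by (rule arg_cong[of _ _ cis]) (simp add: distrib_right mult.assoc)
  then show ?thesis
    by (simp add: monomial2_def torus_rotation_def vector_2 power_mult_distrib mult_ac)
qed

text \<open>The torus through \<open>z\<close> is a compact subset of the punctured ball. A uniform positive lower bound on
  it is what keeps the inequality strict after averaging and passing to the limit.\<close>

lemma torus_min:
  assumes "holomorphic_map_on G (ball 0 1)" "norm z < 1" "z \<noteq> 0"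
    and pos: "\<forall>w \<in> ball 0 1 - {0}. Re (hermitian_inner (- G w) w) > 0"
  shows "\<exists>\<mu>>0. \<forall>k1 k2 t. \<mu> \<le> Re (hermitian_inner (- G (torus_rotation k1 k2 t z)) (torus_rotation k1 k2 t z))"
proof -
  define T where "T = {w :: complex^2. norm (w $ 1) = norm (z $ 1) \<and> norm (w $ 2) = norm (z $ 2)}"
  have norm_T: "norm w = norm z" if "w \<in> T" for w
    using that by (simp add: T_def norm_complex2)
  have "bounded T" by (intro boundedI[of T "norm z"] eq_refl norm_T)
  moreover have "closed T"
    unfolding T_def by (intro closed_Collect_conj closed_Collect_eq continuous_intros)
  ultimately have "compact T" by (simp add: compact_eq_bounded_closed)
  have "isCont G w" if "w \<in> T" for w
    using assms(1,2) norm_T[OF that] has_derivative_continuous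
    by (fastforce simp: holomorphic_map_on_def)
  then have "continuous_on T G" by (simp add: continuous_at_imp_continuous_on)
  then have "continuous_on T (\<lambda>w. Re (hermitian_inner (- G w) w))"
    unfolding hermitian_inner_def by (intro continuous_intros)
  moreover have "z \<in> T" by (simp add: T_def)
  ultimately obtain w where w: "w \<in> T"
    "\<And>v. v \<in> T \<Longrightarrow> Re (hermitian_inner (- G w) w) \<le> Re (hermitian_inner (- G v) v)"
    using continuous_attains_inf[OF \<open>compact T\<close>, of "\<lambda>w. Re (hermitian_inner (- G w) w)"] by blast
  have "norm w < 1" "w \<noteq> 0" using norm_T[OF w(1)] assms(2,3) by auto
  then have "Re (hermitian_inner (- G w) w) > 0" using pos by simp
  moreover have "torus_rotation k1 k2 t z \<in> T" for k1 k2 t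
    by (simp add: T_def torus_rotation_def vector_2 norm_mult)
  ultimately show ?thesis using w(2) by blast
qed

text \<open>Multiplying by the conjugate of the rotated coordinate shifts all frequencies by \<open>k\<close>, so the terms
  of frequency 0 are the resonant ones selected by the projection.\<close>

lemma has_sum_rotated_product:
  assumes "((\<lambda>\<alpha>. c \<alpha> * monomial2 \<alpha> (torus_rotation k1 k2 t z)) has_sum s) UNIV"
  shows "((\<lambda>\<alpha>. c \<alpha> * monomial2 \<alpha> z * (- cnj y)
      * cis (of_int (int (fst \<alpha>) * k1 + int (snd \<alpha>) * k2 - k) * t)) has_sum
      (s * (- cnj (cis (of_int k * t) * y)))) UNIV"
proof -
  have eq: "c \<alpha> * monomial2 \<alpha> (torus_rotation k1 k2 t z) * (- cnj (cis (of_int k * t) * y))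
      = c \<alpha> * monomial2 \<alpha> z * (- cnj y) * cis (of_int (int (fst \<alpha>) * k1 + int (snd \<alpha>) * k2 - k) * t)" for \<alpha>
  proof -
    have "cis (of_int (int (fst \<alpha>) * k1 + int (snd \<alpha>) * k2 - k) * t)
        = cis (of_int (int (fst \<alpha>) * k1 + int (snd \<alpha>) * k2) * t) * cis (- (k * t))"
      by (simp add: cis_mult algebra_simps)
    then show ?thesis
      by (simp add: monomial2_torus_rotation cis_cnj mult_ac)
  qed
  show ?thesis
    using has_sum_cmult_left[OF assms, of "- cnj (cis (of_int k * t) * y)"] by (simp only: eq)
qed

section \<open>The projected field\<close>

theorem mainTheorem1:
  fixes G :: "complex^2 \<Rightarrow> complex^2"
    and q1 q2 :: "nat \<times> nat \<Rightarrow> complex"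
    and k1 k2 :: int
  assumes "autonomous_herglotz G"
    and "has_expansion G q1 q2"
  shows "(\<forall>z \<in> ball 0 1.
            (\<lambda>\<alpha>. q1 \<alpha> * monomial2 \<alpha> z) summable_on indices1 k1 k2 \<and>
            (\<lambda>\<alpha>. q2 \<alpha> * monomial2 \<alpha> z) summable_on indices2 k1 k2)
         \<and> autonomous_herglotz (projected_field k1 k2 q1 q2)"
proof -
  have hol: "holomorphic_map_on G (ball 0 1)"
    and pos: "\<forall>w \<in> ball 0 1 - {0}. Re (hermitian_inner (- G w) w) > 0"
    using assms(1) by (auto simp: autonomous_herglotz_def class_M_def)
  let ?m1 = "\<lambda>\<alpha>. int (fst \<alpha>) * k1 + int (snd \<alpha>) * k2 - k1"
  let ?m2 = "\<lambda>\<alpha>. int (fst \<alpha>) * k1 + int (snd \<alpha>) * k2 - k2"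
  define c1 d1 where "c1 = field_coeff (1, 0) q1 higher_indices"
    and "d1 = field_coeff (1, 0) q1 (indices1 k1 k2)"
  define c2 d2 where "c2 = field_coeff (0, 1) q2 higher_indices"
    and "d2 = field_coeff (0, 1) q2 (indices2 k1 k2)"
  have mon: "monomial2 (1, 0) z = z $ 1" "monomial2 (0, 1) z = z $ 2" for z
    by (simp_all add: monomial2_def)
  have notin: "(1, 0) \<notin> higher_indices" "(0, 1) \<notin> higher_indices"
    "(1, 0) \<notin> indices1 k1 k2" "(0, 1) \<notin> indices2 k1 k2"
    by (auto simp: higher_indices_def indices1_def indices2_def)
  \<comment> \<open>The projection deletes exactly the terms of nonzero frequency.\<close>
  have d1: "d1 \<alpha> = (if ?m1 \<alpha> = 0 then c1 \<alpha> else 0)" for \<alpha>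
    by (auto simp: c1_def d1_def field_coeff_def indices1_def algebra_simps)
  have d2: "d2 \<alpha> = (if ?m2 \<alpha> = 0 then c2 \<alpha> else 0)" for \<alpha>
    by (auto simp: c2_def d2_def field_coeff_def indices2_def algebra_simps)
  interpret e1: ball_expansion "\<lambda>z. G z $ 1" c1
  proof
    show "\<forall>\<^sub>F z in nhds 0. ((\<lambda>\<alpha>. c1 \<alpha> * monomial2 \<alpha> z) has_sum G z $ 1) UNIV"
      using assms(2) unfolding has_expansion_def
    proof eventually_elim
      case (elim z)
      from has_sum_field_coeff[OF notin(1) conjunct1[OF elim]] show ?case
        unfolding c1_def mon by simp
    qed
  qed (rule holomorphic_map_component[OF hol])
  interpret e2: ball_expansion "\<lambda>z. G z $ 2" c2
  proof
    show "\<forall>\<^sub>F z in nhds 0. ((\<lambda>\<alpha>. c2 \<alpha> * monomial2 \<alpha> z) has_sum G z $ 2) UNIV"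
      using assms(2) unfolding has_expansion_def
    proof eventually_elim
      case (elim z)
      from has_sum_field_coeff[OF notin(2) conjunct2[OF elim]] show ?case
        unfolding c2_def mon by simp
    qed
  qed (rule holomorphic_map_component[OF hol])
  have bounded1: "\<exists>M. \<forall>\<alpha>. norm (d1 \<alpha> * monomial2 \<alpha> z) \<le> M" if z: "norm z < 1" for z
  proof -
    obtain M where M: "\<And>\<alpha>. norm (c1 \<alpha> * monomial2 \<alpha> z) \<le> M"
      using e1.terms_bounded[OF z] by blast
    have "norm (d1 \<alpha> * monomial2 \<alpha> z) \<le> M" for \<alpha>
      using M[of \<alpha>] order_trans[OF norm_ge_zero M] by (simp add: d1)
    then show ?thesis by blast
  qed
  have bounded2: "\<exists>M. \<forall>\<alpha>. norm (d2 \<alpha> * monomial2 \<alpha> z) \<le> M" if z: "norm z < 1" for z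
  proof -
    obtain M where M: "\<And>\<alpha>. norm (c2 \<alpha> * monomial2 \<alpha> z) \<le> M"
      using e2.terms_bounded[OF z] by blast
    have "norm (d2 \<alpha> * monomial2 \<alpha> z) \<le> M" for \<alpha>
      using M[of \<alpha>] order_trans[OF norm_ge_zero M] by (simp add: d2)
    then show ?thesis by blast
  qed
  have summable1: "(\<lambda>\<alpha>. d1 \<alpha> * monomial2 \<alpha> z) summable_on UNIV" if "norm z < 1" for z
    by (rule power_series_summable[OF _ that]) (rule bounded1)
  have summable2: "(\<lambda>\<alpha>. d2 \<alpha> * monomial2 \<alpha> z) summable_on UNIV" if "norm z < 1" for z
    by (rule power_series_summable[OF _ that]) (rule bounded2)
  have summable: "(\<lambda>\<alpha>. q1 \<alpha> * monomial2 \<alpha> z) summable_on indices1 k1 k2"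
    "(\<lambda>\<alpha>. q2 \<alpha> * monomial2 \<alpha> z) summable_on indices2 k1 k2" if "norm z < 1" for z
    using summable_on_of_field_coeff[OF notin(3) summable1[OF that, unfolded d1_def]]
      summable_on_of_field_coeff[OF notin(4) summable2[OF that, unfolded d2_def]] .
  define H where "H = projected_field k1 k2 q1 q2"
  define F1 F2 where "F1 z = (\<Sum>\<^sub>\<infinity>\<alpha>. d1 \<alpha> * monomial2 \<alpha> z)"
    and "F2 z = (\<Sum>\<^sub>\<infinity>\<alpha>. d2 \<alpha> * monomial2 \<alpha> z)" for z
  have H: "H z = vector [F1 z, F2 z]" if "norm z < 1" for z
    using infsumI[OF has_sum_field_coeff[OF notin(3) has_sum_infsum[OF summable(1)[OF that]]]]
      infsumI[OF has_sum_field_coeff[OF notin(4) has_sum_infsum[OF summable(2)[OF that]]]]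
    by (simp add: H_def F1_def F2_def d1_def d2_def projected_field_def mon[unfolded One_nat_def])
  let ?p = "\<lambda>d z :: complex^2. \<Sum>\<^sub>\<infinity>(a, b). d (a, b) * (of_nat a * (z $ 1) ^ (a - 1) * (z $ 2) ^ b)"
  let ?q = "\<lambda>d z :: complex^2. \<Sum>\<^sub>\<infinity>(a, b). d (a, b) * ((z $ 1) ^ a * (of_nat b * (z $ 2) ^ (b - 1)))"
  have H_deriv: "(H has_derivative (\<lambda>h. vector [?p d1 z * h $ 1 + ?q d1 z * h $ 2,
      ?p d2 z * h $ 1 + ?q d2 z * h $ 2])) (at z)" if "norm z < 1" for z
  proof -
    have "((\<lambda>z. vector [F1 z, F2 z] :: complex^2) has_derivative (\<lambda>h. vector [?p d1 z * h $ 1 + ?q d1 z * h $ 2,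
      ?p d2 z * h $ 1 + ?q d2 z * h $ 2])) (at z)"
      unfolding F1_def F2_def
      by (intro has_derivative_vector2 power_series_has_derivative bounded1 bounded2 that)
    then show ?thesis
      by (rule has_derivative_transform_within_open[OF _ open_ball[of 0 1]]) (use that H in auto)
  qed
  have holH: "holomorphic_map_on H (ball 0 1)"
    unfolding holomorphic_map_on_def
  proof
    fix z :: "complex^2" assume "z \<in> ball 0 1"
    then show "\<exists>A :: complex^2^2. (H has_derivative (\<lambda>v. A *v v)) (at z)"
      using H_deriv[of z]
      by (intro exI[of _ "vector [vector [?p d1 z, ?q d1 z], vector [?p d2 z, ?q d2 z]]"])
        (simp add: matrix2_vector_mult)
  qed
  have "holomorphic_map_on (\<lambda>z. - H z) (ball 0 1)"
    unfolding holomorphic_map_on_def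
  proof
    fix z :: "complex^2" assume "z \<in> ball 0 1"
    then obtain A :: "complex^2^2" where "(H has_derivative (\<lambda>v. A *v v)) (at z)"
      using holH unfolding holomorphic_map_on_def by fastforce
    moreover have "- (A *v v) = (- A) *v v" for v
      by (simp add: matrix_vector_mult_def vec_eq_iff sum_negf)
    ultimately have "((\<lambda>z. - H z) has_derivative (\<lambda>v. (- A) *v v)) (at z)"
      using has_derivative_minus[of H "\<lambda>v. A *v v" "at z"] by simp
    then show "\<exists>A :: complex^2^2. ((\<lambda>z. - H z) has_derivative (\<lambda>v. A *v v)) (at z)" by blast
  qed
  moreover have "- H 0 = 0"
  proof -
    have "d1 (0, 0) = 0" "d2 (0, 0) = 0"
      by (auto simp: d1_def d2_def field_coeff_def indices1_def indices2_def higher_indices_def)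
    then have "d1 \<alpha> * monomial2 \<alpha> 0 = 0" "d2 \<alpha> * monomial2 \<alpha> 0 = 0" for \<alpha>
      by (cases \<alpha>; auto simp: monomial2_def power_0_left)+
    then have "F1 0 = 0" "F2 0 = 0" unfolding F1_def F2_def by (simp_all only: infsum_0_simp)
    then show ?thesis by (simp add: H vec_eq_iff forall_2 vector_2)
  qed
  moreover have "((\<lambda>z. - H z) has_derivative id) (at 0)"
  proof -
    have "d1 (1, 0) = -1" "d1 (0, 1) = 0" "d2 (1, 0) = 0" "d2 (0, 1) = -1"
      by (auto simp: d1_def d2_def field_coeff_def indices1_def indices2_def higher_indices_def)
    then have "?p d1 0 = -1" "?q d1 0 = 0" "?p d2 0 = 0" "?q d2 0 = -1"
      unfolding zero_index infsum_partial_at_0 by simp_all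
    moreover have "vector [- 1 * h $ 1 + 0 * h $ 2, 0 * h $ 1 + - 1 * h $ 2] = - h"
      for h :: "complex^2"
      by (simp add: vec_eq_iff forall_2 vector_2)
    ultimately have "(H has_derivative (\<lambda>h. - h)) (at 0)"
      using H_deriv[of 0] by simp
    from has_derivative_minus[OF this] show ?thesis by (simp add: id_def)
  qed
  moreover have "Re (hermitian_inner (- H z) z) > 0" if z: "norm z < 1" "z \<noteq> 0" for z
  proof -
    let ?R = "\<lambda>t. torus_rotation k1 k2 t z"
    obtain \<mu> where "\<mu> > 0" and \<mu>: "\<And>t. \<mu> \<le> Re (hermitian_inner (- G (?R t)) (?R t))"
      using torus_min[OF hol z pos] by blast
    have norm_R: "norm (?R t) < 1" for t
      using z(1) by (simp add: norm_complex2 torus_rotation_def vector_2 norm_mult)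
    \<comment> \<open>The averaged function is the sum of the two components of the Hermitian product along the orbit.\<close>
    have "\<mu> \<le> Re (F1 z * (- cnj (z $ 1)) + F2 z * (- cnj (z $ 2)))"
    proof (rule circle_average_Re_ge)
      show "((\<lambda>\<alpha>. c1 \<alpha> * monomial2 \<alpha> z * (- cnj (z $ 1)) * cis (of_int (?m1 \<alpha>) * t)) has_sum
          (G (?R t) $ 1 * (- cnj (cis (of_int k1 * t) * z $ 1)))) UNIV" for t :: real
        by (intro has_sum_rotated_product e1.has_sum_on_ball norm_R)
      show "((\<lambda>\<alpha>. c2 \<alpha> * monomial2 \<alpha> z * (- cnj (z $ 2)) * cis (of_int (?m2 \<alpha>) * t)) has_sum
          (G (?R t) $ 2 * (- cnj (cis (of_int k2 * t) * z $ 2)))) UNIV" for t :: real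
        by (intro has_sum_rotated_product e2.has_sum_on_ball norm_R)
      show "((\<lambda>\<alpha>. if ?m1 \<alpha> = 0 then c1 \<alpha> * monomial2 \<alpha> z * (- cnj (z $ 1)) else 0) has_sum
          F1 z * (- cnj (z $ 1))) UNIV"
      proof -
        have "(if ?m1 \<alpha> = 0 then c1 \<alpha> * monomial2 \<alpha> z * (- cnj (z $ 1)) else 0)
            = d1 \<alpha> * monomial2 \<alpha> z * (- cnj (z $ 1))" for \<alpha>
          by (simp add: d1)
        then show ?thesis
          unfolding F1_def
          using has_sum_cmult_left[OF has_sum_infsum[OF summable1[OF z(1)]], of "- cnj (z $ 1)"]
          by (simp only:)
      qed
      show "((\<lambda>\<alpha>. if ?m2 \<alpha> = 0 then c2 \<alpha> * monomial2 \<alpha> z * (- cnj (z $ 2)) else 0) has_sum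
          F2 z * (- cnj (z $ 2))) UNIV"
      proof -
        have "(if ?m2 \<alpha> = 0 then c2 \<alpha> * monomial2 \<alpha> z * (- cnj (z $ 2)) else 0)
            = d2 \<alpha> * monomial2 \<alpha> z * (- cnj (z $ 2))" for \<alpha>
          by (simp add: d2)
        then show ?thesis
          unfolding F2_def
          using has_sum_cmult_left[OF has_sum_infsum[OF summable2[OF z(1)]], of "- cnj (z $ 2)"]
          by (simp only:)
      qed
      show "\<mu> \<le> Re (G (?R t) $ 1 * (- cnj (cis (of_int k1 * t) * z $ 1))
          + G (?R t) $ 2 * (- cnj (cis (of_int k2 * t) * z $ 2)))" for t :: real
      proof -
        have "?R t $ 1 = cis (of_int k1 * t) * z $ 1" "?R t $ 2 = cis (of_int k2 * t) * z $ 2"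
          by (simp_all add: torus_rotation_def vector_2)
        then show ?thesis using \<mu>[of t] by (simp add: hermitian_inner_def)
      qed
    qed
    then show ?thesis
      using \<open>\<mu> > 0\<close> by (simp add: hermitian_inner_def H[OF z(1)] vector_2)
  qed
  ultimately have "(\<lambda>z. - H z) \<in> class_M"
    by (auto simp: class_M_def)
  then show ?thesis
    using summable holH by (auto simp: autonomous_herglotz_def H_def)
qed

end
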